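(* Let $B < A$ be non-negative integers. The set $\mathcal{P}$ of Dyck paths whose up-run lengths avoid $\{Ar + B \mid r \geq 0\}$ has the unambiguous grammar $$\mathcal{P} = \bigcup_{\substack{0 \leq k < A \\ k \neq B}} U^k (D\mathcal{P})^k \ \cup\ U^A (\mathcal{P}D)^A \mathcal{P},$$ and therefore $$P(z) = \sum_{\substack{0 \leq k < A \\ k \neq B}} z^k P(z)^k + z^A P(z)^{A+1},$$ where $P(z)$ is the weight-enumerator of $\mathcal{P}$.
   Context: A Dyck path is a finite (possibly empty) word in the letters $U$ (standing for $+1$) and $D$ (standing for $-1$) whose partial sums are all nonnegative and whose total sum is $0$. A Dyck path of length $2n$ is said to have semilength $n$. A Dyck path has an up-run of length $n$ provided that it contains at least one $U^n$ (that is, $n$ consecutive $U$'s) that is neither preceded nor followed by $U$. The up-run lengths of a path avoid a set $S$ if the path has no up-run whose length lies in $S$. In the grammar, sets of words over $\{U,D\}$ are combined by concatenation: for languages $L, L'$, $LL'$ is the set of words $ww'$ with $w\in L$, $w'\in L'$; $L^k$ is the $k$-fold concatenation, with $L^0=\{\epsilon\}$ where $\epsilon$ is the empty word; $U$ and $D$ denote the one-letter languages. An occurrence of $\mathcal{P}$ in an expression stands for any (possibly vertically shifted) Dyck path from $\mathcal{P}$. The grammar being unambiguous means that each word of $\mathcal{P}$ is parsed uniquely: it belongs to exactly one of the cases of the union and, within that case, has exactly one factorization of the displayed form. The weight-enumerator of $\mathcal{P}$ is the formal power series $P(z) = \sum_{n \geq 0} p_n z^n$, where $p_n$ is the number of paths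 of semilength $n$ in $\mathcal{P}$. *)

theory Defs
  imports "HOL-Computational_Algebra.Formal_Power_Series"
begin

datatype step = U | D

type_synonym word = "step list"

primrec step_val :: "step \<Rightarrow> int" where
  "step_val U = 1"
| "step_val D = -1"

definition height :: "word \<Rightarrow> int" where
  "height w = (\<Sum>s\<leftarrow>w. step_val s)"

definition dyck_path :: "word \<Rightarrow> bool" where
  "dyck_path w \<longleftrightarrow> (\<forall>i\<le>length w. 0 \<le> height (take i w)) \<and> height w = 0"

text \<open>The case \<open>n = 0\<close> is deliberately not excluded: an empty factor that is not adjacent to
  any \<open>U\<close> is an up-run of length 0.  Every Dyck path has one, namely at its end, so no Dyck path
  avoids a set of lengths that contains 0.\<close>

definition has_up_run :: "word \<Rightarrow> nat \<Rightarrow> bool" where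
  "has_up_run w n \<longleftrightarrow>
     (\<exists>xs ys. w = xs @ replicate n U @ ys \<and>
        \<not> (xs \<noteq> [] \<and> last xs = U) \<and> \<not> (ys \<noteq> [] \<and> hd ys = U))"

definition avoiding_paths :: "nat set \<Rightarrow> word set" where
  "avoiding_paths S = {w. dyck_path w \<and> (\<forall>n\<in>S. \<not> has_up_run w n)}"

definition conc :: "word set \<Rightarrow> word set \<Rightarrow> word set" (infixr "@@" 75) where
  "L @@ L' = {w @ w' |w w'. w \<in> L \<and> w' \<in> L'}"

primrec lang_pow :: "word set \<Rightarrow> nat \<Rightarrow> word set" where
  "lang_pow L 0 = {[]}"
| "lang_pow L (Suc k) = L @@ lang_pow L k"

text \<open>The languages \<open>U\<^sup>k (D P)\<^sup>k\<close> and \<open>U\<^sup>A (P D)\<^sup>A P\<close>.\<close>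

definition short_case :: "word set \<Rightarrow> nat \<Rightarrow> word set" where
  "short_case P k = lang_pow {[U]} k @@ lang_pow ({[D]} @@ P) k"

definition long_case :: "word set \<Rightarrow> nat \<Rightarrow> word set" where
  "long_case P A = lang_pow {[U]} A @@ lang_pow (P @@ {[D]}) A @@ P"

text \<open>Factorizations of \<open>w\<close> in the two forms.  The letters are forced, so a factorization is
  given by the words of \<open>P\<close> at the successive occurrences of \<open>P\<close>.\<close>

definition short_factorization :: "word set \<Rightarrow> nat \<Rightarrow> word \<Rightarrow> word list \<Rightarrow> bool" where
  "short_factorization P k w ps \<longleftrightarrow>
     length ps = k \<and> set ps \<subseteq> P \<and>
     w = replicate k U @ concat (map (\<lambda>p. [D] @ p) ps)"

definition long_factorization :: "word set \<Rightarrow> nat \<Rightarrow> word \<Rightarrow> word list \<times> word \<Rightarrow> bool" where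
  "long_factorization P A w f \<longleftrightarrow>
     (case f of (ps, q) \<Rightarrow>
        length ps = A \<and> set ps \<subseteq> P \<and> q \<in> P \<and>
        w = replicate A U @ concat (map (\<lambda>p. p @ [D]) ps) @ q)"

definition weight_enumerator :: "word set \<Rightarrow> int fps" where
  "weight_enumerator P = Abs_fps (\<lambda>n. int (card {w \<in> P. length w = 2 * n}))"

end

(* A Dyck path starting with exactly k up-steps, k < A, is U^k followed by a walk from height k
   to 0 that starts with D; one starting with at least A up-steps is U^A followed by an arbitrary
   walk from height A to 0.  Cutting a walk from height h to 0 at the first visits to
   h - 1, ..., 0 writes it uniquely as p D p D ... D q with h + 1 Dyck factors.
   Listing the lengths of all maximal (possibly empty) blocks of U between consecutive D's, the
   list of the whole walk is the concatenation of those of the factors, and putting U^A in front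
   only adds A to the first entry, which does not change its residue mod A. *)
theory Submission
  imports Defs
begin

section \<open>Walks and up-runs\<close>

text \<open>The starting height is a natural number, so nonnegativity is built in: the only
  forbidden move is a \<open>D\<close> at height 0.\<close>

fun walk :: "nat \<Rightarrow> word \<Rightarrow> bool" where
  "walk h [] \<longleftrightarrow> h = 0"
| "walk h (U # w) \<longleftrightarrow> walk (Suc h) w"
| "walk 0 (D # w) \<longleftrightarrow> False"
| "walk (Suc h) (D # w) \<longleftrightarrow> walk h w"

text \<open>Empty blocks get an entry as well, so a word with m letters \<open>D\<close> has m + 1
  entries. This makes cutting at a \<open>D\<close> split the list exactly, and it matches the
  convention of \<open>has_up_run\<close> for length 0.\<close>

fun up_runs :: "word \<Rightarrow> nat list" where
  "up_runs [] = [0]"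
| "up_runs (D # w) = 0 # up_runs w"
| "up_runs (U # w) = Suc (hd (up_runs w)) # tl (up_runs w)"

lemma height_Nil [simp]: "height [] = 0"
  and height_Cons [simp]: "height (s # w) = step_val s + height w"
  by (simp_all add: height_def)

lemma all_le_Suc_iff: "(\<forall>i\<le>Suc n. Q i) \<longleftrightarrow> Q 0 \<and> (\<forall>i\<le>n. Q (Suc i))"
  by (metis Suc_le_mono not0_implies_Suc zero_le)

lemma walk_iff_height:
  "walk h w \<longleftrightarrow> (\<forall>i\<le>length w. 0 \<le> int h + height (take i w)) \<and> int h + height w = 0"
proof (induction h w rule: walk.induct)
  case (3 w)
  \<comment> \<open>The prefix of length 1 already violates nonnegativity.\<close>
  have "\<not> 0 \<le> height (take (Suc 0) (D # w))" by simp
  moreover have "Suc 0 \<le> length (D # w)" by simp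
  ultimately show ?case by (metis add_0 of_nat_0 walk.simps(3))
qed (auto simp: all_le_Suc_iff algebra_simps)

lemma dyck_path_iff_walk: "dyck_path w \<longleftrightarrow> walk 0 w"
  by (simp add: dyck_path_def walk_iff_height)

lemma walk_append: "walk a p \<Longrightarrow> walk (a + h) (p @ w) \<longleftrightarrow> walk h w"
  by (induction a p rule: walk.induct) auto

lemma walk_replicate [simp]: "walk h (replicate k U @ w) \<longleftrightarrow> walk (h + k) w"
  by (induction k arbitrary: h) auto

lemma even_length_walk: "walk h w \<Longrightarrow> even (h + length w)"
  by (induction h w rule: walk.induct) auto

text \<open>Heights change by one, so a walk that starts above h must step from h + 1 to h. The
  displayed \<open>D\<close> is the first such step; \<open>p\<close> is what precedes it, lowered
  by h + 1. The offset \<open>a\<close> is general because an up-step raises it in the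
  induction.\<close>

lemma walk_split: "walk (a + Suc h) w \<Longrightarrow> \<exists>p v. w = p @ D # v \<and> walk a p \<and> walk h v"
proof (induction w arbitrary: a)
  case (Cons s w)
  show ?case
  proof (cases s)
    case U
    with Cons.prems have "walk (Suc a + Suc h) w" by simp
    with Cons.IH U show ?thesis by (metis append_Cons walk.simps(2))
  next
    case D
    show ?thesis
    proof (cases a)
      case 0
      with D Cons.prems show ?thesis by (intro exI[of _ "[]"] exI[of _ w]) simp
    next
      case (Suc b)
      with D Cons.prems have "walk (b + Suc h) w" by simp
      with Cons.IH D Suc show ?thesis by (metis append_Cons walk.simps(4))
    qed
  qed
qed simp

text \<open>Read both sides letter by letter. The current relative height settles the role of the
  next \<open>D\<close>: at 0 it has to be the separator, above 0 it has to belong to the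
  factor.\<close>

lemma walk_split_unique:
  "walk a p \<Longrightarrow> walk a q \<Longrightarrow> p @ D # v = q @ D # w \<Longrightarrow> p = q \<and> v = w"
proof (induction a p arbitrary: q rule: walk.induct)
  case (1 h)
  then show ?case by (cases q) auto
next
  case (2 h p)
  from "2.prems" obtain q' where q: "q = U # q'" by (cases q) auto
  have "p = q' \<and> v = w" by (intro "2.IH") (use "2.prems" q in simp_all)
  with q show ?case by simp
next
  case (4 h p)
  from "4.prems" obtain q' where q: "q = D # q'" by (cases q) auto
  have "p = q' \<and> v = w" by (intro "4.IH") (use "4.prems" q in simp_all)
  with q show ?case by simp
qed simp

section \<open>Block lengths and their agreement with the given notion of up-run\<close>

lemma up_runs_nonempty [simp]: "up_runs w \<noteq> []"
  by (cases w rule: up_runs.cases) auto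

lemma up_runs_append_D [simp]: "up_runs (v @ D # w) = up_runs v @ up_runs w"
  by (induction v rule: up_runs.induct) auto

lemma up_runs_replicate [simp]:
  "up_runs (replicate k U @ w) = (k + hd (up_runs w)) # tl (up_runs w)"
  by (induction k) auto

lemma up_runs_replicate_Nil [simp]: "up_runs (replicate k U) = [k]"
  using up_runs_replicate[of k "[]"] by simp

lemma word_first_run:
  obtains k where "w = replicate k U"
  | k v where "w = replicate k U @ D # v"
proof (induction w arbitrary: thesis)
  case Nil
  then show ?case by (metis replicate_0)
next
  case (Cons s w)
  show ?case
  proof (cases s)
    case U
    with Cons show ?thesis by (metis append_Cons replicate_Suc)
  next
    case D
    with Cons.prems(2)[of 0 w] show ?thesis by simp
  qed
qed

lemma has_up_run_iff: "has_up_run w n \<longleftrightarrow> n \<in> set (up_runs w)"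
proof
  assume "has_up_run w n"
  then obtain xs ys where w: "w = xs @ replicate n U @ ys"
    and xs: "\<not> (xs \<noteq> [] \<and> last xs = U)" and ys: "\<not> (ys \<noteq> [] \<and> hd ys = U)"
    unfolding has_up_run_def by blast
  \<comment> \<open>No \<open>U\<close> is adjacent to the block, so on either side there is a
    \<open>D\<close> or the end of the word; cutting there isolates \<open>n\<close> as an
    entry.\<close>
  have "ys = [] \<or> (\<exists>zs. ys = D # zs)"
    using ys by (metis list.exhaust_sel step.exhaust)
  then have n: "n \<in> set (up_runs (replicate n U @ ys))" by auto
  have "xs = [] \<or> (\<exists>zs. xs = zs @ [D])"
    using xs by (metis append_butlast_last_id step.exhaust)
  with n w show "n \<in> set (up_runs w)" by auto
next
  show "n \<in> set (up_runs w) \<Longrightarrow> has_up_run w n"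
  \<comment> \<open>Each induction step removes the first block together with the \<open>D\<close>
    after it.\<close>
  proof (induction w rule: measure_induct_rule[of length])
    case (less w)
    show ?case
    proof (cases w rule: word_first_run)
      case (1 k)
      with less.prems have "w = [] @ replicate n U @ []" by simp
      then show ?thesis unfolding has_up_run_def by blast
    next
      case (2 k v)
      show ?thesis
      proof (cases "n = k")
        case True
        with 2 have "w = [] @ replicate n U @ D # v" by simp
        then show ?thesis
          unfolding has_up_run_def by (metis list.sel(1) step.distinct(1))
      next
        case False
        with 2 less.prems have "n \<in> set (up_runs v)" by simp
        with less.IH 2 have "has_up_run v n" by simp
        then obtain xs ys where v: "v = xs @ replicate n U @ ys"
          and xs: "\<not> (xs \<noteq> [] \<and> last xs = U)" and ys: "\<not> (ys \<noteq> [] \<and> hd ys = U)"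
          unfolding has_up_run_def by blast
        have "w = (replicate k U @ D # xs) @ replicate n U @ ys"
          using 2 v by simp
        \<comment> \<open>If \<open>xs\<close> is empty, the letter before the block is now the
          separating \<open>D\<close>.\<close>
        moreover have "last (replicate k U @ D # xs) \<noteq> U"
          using xs by (cases "xs = []") auto
        ultimately show ?thesis using ys unfolding has_up_run_def by blast
      qed
    qed
  qed
qed

section \<open>Factoring a walk into Dyck paths\<close>

text \<open>The shape p D p D ... p D q underlies both forms of the grammar: the long one is U^A
  followed by a descent, the short one with k > 0 is U^k D followed by a descent with k - 1
  separators.\<close>

definition descent :: "word list \<Rightarrow> word \<Rightarrow> word" where
  "descent ps q = concat (map (\<lambda>p. p @ [D]) ps) @ q"

lemma descent_Nil [simp]: "descent [] q = q"
  and descent_Cons [simp]: "descent (p # ps) q = p @ D # descent ps q"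
  by (simp_all add: descent_def)

lemma length_descent: "length (descent ps q) = length ps + sum_list (map length ps) + length q"
  by (induction ps) auto

lemma up_runs_descent: "up_runs (descent ps q) = concat (map up_runs ps) @ up_runs q"
  by (induction ps) auto

lemma walk_descent:
  "(\<forall>p\<in>set ps. walk 0 p) \<Longrightarrow> walk 0 q \<Longrightarrow> walk (length ps) (descent ps q)"
proof (induction ps)
  case (Cons p ps)
  then show ?case
    using walk_append[of 0 p "Suc (length ps)" "D # descent ps q"] by simp
qed simp

text \<open>Each use of \<open>walk_split\<close> with offset 0 cuts at the first visit to the next
  lower level, so the part cut off is a Dyck path.\<close>

lemma walk_descent_exists:
  "walk h w \<Longrightarrow> \<exists>ps q. length ps = h \<and> (\<forall>p\<in>set ps. walk 0 p) \<and> walk 0 q \<and> w = descent ps q"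
proof (induction h arbitrary: w)
  case 0
  then show ?case by (intro exI[of _ "[]"] exI[of _ w]) simp
next
  case (Suc h)
  then obtain p v where "w = p @ D # v" "walk 0 p" "walk h v"
    using walk_split[of 0 h w] by auto
  moreover from Suc.IH[OF \<open>walk h v\<close>] obtain ps q
    where "length ps = h" "\<forall>p\<in>set ps. walk 0 p" "walk 0 q" "v = descent ps q" by blast
  ultimately have "length (p # ps) = Suc h \<and> (\<forall>p\<in>set (p # ps). walk 0 p) \<and> walk 0 q \<and>
      w = descent (p # ps) q"
    by simp
  then show ?case by blast
qed

lemma descent_inject:
  assumes "length ps = length ps'" "\<forall>p\<in>set ps. walk 0 p" "\<forall>p\<in>set ps'. walk 0 p"
    "descent ps q = descent ps' q'"
  shows "ps = ps' \<and> q = q'"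
  using assms
proof (induction ps ps' rule: list_induct2)
  case (Cons p ps p' ps')
  have p: "p = p' \<and> descent ps q = descent ps' q'"
    by (intro walk_split_unique[of 0]) (use Cons.prems in simp_all)
  then have "ps = ps' \<and> q = q'"
    by (intro Cons.IH) (use Cons.prems in simp_all)
  with p show ?case by simp
qed simp

text \<open>Regrouping: every \<open>D\<close> but the first is attached to the factor on its left.
  This carries the results on \<open>descent\<close> over to the short form.\<close>

lemma concat_map_Cons_D: "concat (map ((#) D) (ps @ [q])) = D # descent ps q"
  by (induction ps) auto

lemma concat_map_Cons_D_inject:
  assumes "length ps = length ps'" "\<forall>p\<in>set ps. walk 0 p" "\<forall>p\<in>set ps'. walk 0 p"
    "concat (map ((#) D) ps) = concat (map ((#) D) ps')"
  shows "ps = ps'"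
proof (cases ps rule: rev_cases)
  case Nil
  with assms show ?thesis by simp
next
  case (snoc qs q)
  with assms(1) obtain qs' q' where ps': "ps' = qs' @ [q']"
    by (cases ps' rule: rev_cases) auto
  with snoc assms show ?thesis
    using descent_inject[of qs qs' q q'] by (simp add: concat_map_Cons_D del: map_append concat_append)
qed

section \<open>Factorizations and languages\<close>

lemma lang_pow_eq: "lang_pow L k = {concat ws |ws. length ws = k \<and> set ws \<subseteq> L}"
proof (induction k)
  case (Suc k)
  show ?case
  proof (intro set_eqI iffI)
    fix x assume "x \<in> lang_pow L (Suc k)"
    then obtain v ws where "x = v @ concat ws" "v \<in> L" "length ws = k" "set ws \<subseteq> L"
      by (auto simp: conc_def Suc)
    then show "x \<in> {concat ws |ws. length ws = Suc k \<and> set ws \<subseteq> L}"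
      by (intro CollectI exI[of _ "v # ws"]) simp
  next
    fix x assume "x \<in> {concat ws |ws. length ws = Suc k \<and> set ws \<subseteq> L}"
    then show "x \<in> lang_pow L (Suc k)"
      by (fastforce simp: conc_def Suc length_Suc_conv)
  qed
qed auto

text \<open>Meant for \<open>f\<close> attaching a \<open>D\<close> to the left or to the right of a
  word; it replaces powers of a language by lists of its words, the data of a factorization.\<close>

lemma lang_pow_image: "lang_pow (f ` L) k = {concat (map f ps) |ps. length ps = k \<and> set ps \<subseteq> L}"
proof -
  have "{ws. length ws = k \<and> set ws \<subseteq> f ` L} = map f ` {ps. length ps = k \<and> set ps \<subseteq> L}"
    using lists_image[of f L] by (auto simp: lists_eq_set set_eq_iff image_iff)
  then have "concat ` {ws. length ws = k \<and> set ws \<subseteq> f ` L} =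
      (\<lambda>ps. concat (map f ps)) ` {ps. length ps = k \<and> set ps \<subseteq> L}"
    by (simp add: image_image)
  then show ?thesis
    unfolding lang_pow_eq by (simp only: setcompr_eq_image)
qed

lemma lang_pow_U: "lang_pow {[U]} k = {replicate k U}"
  by (induction k) (auto simp: conc_def)

lemma short_case_iff: "w \<in> short_case P k \<longleftrightarrow> (\<exists>ps. short_factorization P k w ps)"
proof -
  have D: "{[D]} @@ P = (\<lambda>p. [D] @ p) ` P"
    unfolding conc_def by blast
  show ?thesis
    unfolding short_case_def lang_pow_U short_factorization_def D lang_pow_image
    unfolding conc_def by blast
qed

lemma long_case_iff: "w \<in> long_case P A \<longleftrightarrow> (\<exists>f. long_factorization P A w f)"
proof -
  have D: "P @@ {[D]} = (\<lambda>p. p @ [D]) ` P"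
    unfolding conc_def by blast
  show ?thesis
    unfolding long_case_def lang_pow_U long_factorization_def D lang_pow_image split_paired_Ex case_prod_conv
    unfolding conc_def by blast
qed

lemma short_factorization_unique:
  assumes "\<forall>p\<in>P. walk 0 p" "short_factorization P k w ps" "short_factorization P k w ps'"
  shows "ps = ps'"
  using assms concat_map_Cons_D_inject[of ps ps'] by (auto simp: short_factorization_def)

lemma long_factorization_unique:
  assumes "\<forall>p\<in>P. walk 0 p" "long_factorization P A w f" "long_factorization P A w f'"
  shows "f = f'"
  using assms descent_inject[of "fst f" "fst f'" "snd f" "snd f'"]
  by (auto simp: long_factorization_def descent_def split: prod.splits)

section \<open>Counting\<close>

definition slice :: "word set \<Rightarrow> nat \<Rightarrow> word set" where
  "slice L n = {w \<in> L. length w = 2 * n}"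

text \<open>These lists are what the coefficient of z^n in the k-th power of the weight-enumerator
  counts.\<close>

definition tuples :: "word set \<Rightarrow> nat \<Rightarrow> nat \<Rightarrow> word list set" where
  "tuples P k n = {ps. length ps = k \<and> set ps \<subseteq> P \<and> sum_list (map length ps) = 2 * n}"

lemma UNIV_step: "(UNIV :: step set) = {U, D}"
  using step.exhaust by auto

lemma finite_slice [simp]: "finite (slice L n)"
proof -
  have "finite {w :: word. set w \<subseteq> UNIV \<and> length w = 2 * n}"
    by (rule finite_lists_length_eq) (simp add: UNIV_step)
  then show ?thesis by (rule finite_subset[rotated]) (auto simp: slice_def)
qed

lemma weight_enumerator_nth: "fps_nth (weight_enumerator L) n = int (card (slice L n))"
  by (simp add: weight_enumerator_def slice_def)

text \<open>By evenness the first word has a semilength i, which leaves n - i for the others. This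
  is the index set of the Cauchy product.\<close>

lemma tuples_Suc:
  assumes "\<forall>p\<in>P. even (length p)"
  shows "tuples P (Suc k) n =
    (\<lambda>(p, ps). p # ps) ` (\<Union>i\<in>{0..n}. slice P i \<times> tuples P k (n - i))"
proof (intro set_eqI iffI)
  fix qs assume "qs \<in> tuples P (Suc k) n"
  then obtain p ps where qs: "qs = p # ps" "length ps = k" "p \<in> P" "set ps \<subseteq> P"
    "length p + sum_list (map length ps) = 2 * n"
    by (auto simp: tuples_def length_Suc_conv)
  moreover from assms qs obtain i where "length p = 2 * i" by blast
  ultimately show "qs \<in> (\<lambda>(p, ps). p # ps) ` (\<Union>i\<in>{0..n}. slice P i \<times> tuples P k (n - i))"
    by (intro image_eqI[of _ _ "(p, ps)"]) (auto simp: slice_def tuples_def)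
qed (auto simp: slice_def tuples_def)

lemma finite_tuples:
  assumes "\<forall>p\<in>P. even (length p)"
  shows "finite (tuples P k n)"
proof (induction k arbitrary: n)
  case 0
  have "tuples P 0 n \<subseteq> {[]}" by (auto simp: tuples_def)
  then show ?case by (rule finite_subset) simp
qed (simp add: tuples_Suc[OF assms])

lemma weight_enumerator_power_nth:
  assumes "\<forall>p\<in>P. even (length p)"
  shows "fps_nth (weight_enumerator P ^ k) n = int (card (tuples P k n))"
proof (induction k arbitrary: n)
  case 0
  have "tuples P 0 n = (if n = 0 then {[]} else {})" by (auto simp: tuples_def)
  then show ?case by simp
next
  case (Suc k)
  have "card (tuples P (Suc k) n) = card (\<Union>i\<in>{0..n}. slice P i \<times> tuples P k (n - i))"
    unfolding tuples_Suc[OF assms] by (intro card_image) (auto simp: inj_on_def)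
  also have "\<dots> = (\<Sum>i=0..n. card (slice P i \<times> tuples P k (n - i)))"
    \<comment> \<open>The length of the first component determines \<open>i\<close>, so the pieces
      are disjoint.\<close>
    by (intro card_UN_disjoint) (auto simp: finite_tuples[OF assms], auto simp: slice_def)
  finally show ?case
    by (simp add: fps_mult_nth weight_enumerator_nth Suc card_cartesian_product)
qed

lemma card_slice_short_case:
  assumes "\<forall>p\<in>P. walk 0 p"
  shows "int (card (slice (short_case P k) n)) = fps_nth (fps_X ^ k * weight_enumerator P ^ k) n"
proof (cases "n < k")
  case True
  \<comment> \<open>The k letters \<open>U\<close> and k letters \<open>D\<close> outside the
    factors already exceed length 2 n.\<close>
  have "slice (short_case P k) n = {}"
    using True
    by (auto simp: slice_def short_case_iff short_factorization_def length_concat comp_def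
        sum_list_Suc)
  with True show ?thesis by (simp add: fps_X_power_mult_nth)
next
  case False
  \<comment> \<open>The letters outside the factors use semilength k, so the factors share n - k;
    injectivity is uniqueness of the factorization.\<close>
  have "bij_betw (\<lambda>ps. replicate k U @ concat (map (\<lambda>p. [D] @ p) ps))
      (tuples P k (n - k)) (slice (short_case P k) n)"
    unfolding bij_betw_def
  proof
    show "inj_on (\<lambda>ps. replicate k U @ concat (map (\<lambda>p. [D] @ p) ps)) (tuples P k (n - k))"
      using short_factorization_unique[OF assms]
      by (fastforce intro!: inj_onI simp: short_factorization_def tuples_def)
    show "(\<lambda>ps. replicate k U @ concat (map (\<lambda>p. [D] @ p) ps)) ` tuples P k (n - k) =
        slice (short_case P k) n"
      using False
      by (auto simp: tuples_def slice_def short_case_iff short_factorization_def length_concat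
          comp_def sum_list_Suc)
  qed
  then have "card (slice (short_case P k) n) = card (tuples P k (n - k))"
    by (simp add: bij_betw_same_card)
  moreover have "\<forall>p\<in>P. even (length p)"
    using assms even_length_walk[of 0] by auto
  ultimately show ?thesis
    using False by (simp add: fps_X_power_mult_nth weight_enumerator_power_nth)
qed

text \<open>Merging the A factors and the final word into one list of length A + 1 lets
  \<open>tuples\<close> count them; this is the source of the exponent A + 1.\<close>

lemma long_case_eq_image:
  "long_case P A = (\<lambda>ps. replicate A U @ descent (butlast ps) (last ps)) `
    {ps. length ps = Suc A \<and> set ps \<subseteq> P}"
proof (intro set_eqI iffI)
  fix w assume "w \<in> long_case P A"
  then obtain ps q where "length ps = A" "set ps \<subseteq> P" "q \<in> P" "w = replicate A U @ descent ps q"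
    by (auto simp: long_case_iff long_factorization_def descent_def)
  then show "w \<in> (\<lambda>ps. replicate A U @ descent (butlast ps) (last ps)) `
    {ps. length ps = Suc A \<and> set ps \<subseteq> P}"
    by (intro image_eqI[of _ _ "ps @ [q]"]) auto
next
  fix w assume "w \<in> (\<lambda>ps. replicate A U @ descent (butlast ps) (last ps)) `
    {ps. length ps = Suc A \<and> set ps \<subseteq> P}"
  then obtain ps q where "length ps = A" "set ps \<subseteq> P" "q \<in> P" "w = replicate A U @ descent ps q"
    by (auto simp: length_Suc_conv_rev)
  then show "w \<in> long_case P A"
    by (auto simp: long_case_iff long_factorization_def descent_def)
qed

lemma card_slice_long_case:
  assumes "\<forall>p\<in>P. walk 0 p"
  shows "int (card (slice (long_case P A) n)) =
    fps_nth (fps_X ^ A * weight_enumerator P ^ (A + 1)) n"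
proof -
  define f where "f ps = replicate A U @ descent (butlast ps) (last ps)" for ps
  have len: "length (f ps) = 2 * A + sum_list (map length ps)" if "length ps = Suc A" for ps
    using that by (cases ps rule: rev_cases) (auto simp: f_def length_descent)
  have image: "long_case P A = f ` {ps. length ps = Suc A \<and> set ps \<subseteq> P}"
    by (simp add: long_case_eq_image f_def)
  show ?thesis
  proof (cases "n < A")
    case True
    then have "slice (long_case P A) n = {}"
      by (auto simp: slice_def image len)
    with True show ?thesis by (simp add: fps_X_power_mult_nth)
  next
    case False
    have "bij_betw f (tuples P (Suc A) (n - A)) (slice (long_case P A) n)"
      unfolding bij_betw_def
    proof
      show "inj_on f (tuples P (Suc A) (n - A))"
      proof (rule inj_onI)
        fix ps ps'
        assume "ps \<in> tuples P (Suc A) (n - A)" "ps' \<in> tuples P (Suc A) (n - A)"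
          and eq: "f ps = f ps'"
        then obtain qs q qs' q' where split: "ps = qs @ [q]" "ps' = qs' @ [q']"
          and "length qs = length qs'" "set qs \<subseteq> P" "set qs' \<subseteq> P"
          by (auto simp: tuples_def length_Suc_conv_rev)
        moreover from eq have "descent qs q = descent qs' q'"
          by (simp add: f_def split)
        ultimately have "qs = qs' \<and> q = q'"
          using assms by (intro descent_inject) auto
        then show "ps = ps'" by (simp add: split)
      qed
      show "f ` tuples P (Suc A) (n - A) = slice (long_case P A) n"
        using False by (auto simp: tuples_def slice_def image len)
    qed
    then have "card (slice (long_case P A) n) = card (tuples P (Suc A) (n - A))"
      by (simp add: bij_betw_same_card)
    moreover have "\<forall>p\<in>P. even (length p)"
      using assms even_length_walk[of 0] by auto
    ultimately show ?thesis
      using False weight_enumerator_power_nth[of P "Suc A"] by (simp add: fps_X_power_mult_nth)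
  qed
qed

section \<open>Avoiding a residue class\<close>

definition avoids_residue :: "nat \<Rightarrow> nat \<Rightarrow> word \<Rightarrow> bool" where
  "avoids_residue A B w \<longleftrightarrow> (\<forall>n\<in>set (up_runs w). n mod A \<noteq> B)"

lemma avoids_residue_descent:
  "avoids_residue A B (descent ps q) \<longleftrightarrow>
    (\<forall>p\<in>set ps. avoids_residue A B p) \<and> avoids_residue A B q"
  by (auto simp: avoids_residue_def up_runs_descent)

lemma avoids_residue_replicate:
  "avoids_residue A B (replicate A U @ w) \<longleftrightarrow> avoids_residue A B w"
  unfolding avoids_residue_def up_runs_replicate
  by (metis list.collapse list.set_intros list.simps(15) mod_add_self1 set_ConsD up_runs_nonempty)

text \<open>Since B < A, the forbidden lengths form the full residue class of B modulo A.\<close>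

lemma avoiding_paths_residue:
  assumes "B < A"
  shows "w \<in> avoiding_paths {A * r + B |r. r \<ge> 0} \<longleftrightarrow> walk 0 w \<and> avoids_residue A B w"
proof -
  have "{A * r + B |r. r \<ge> 0} = {n. n mod A = B}"
  proof (intro set_eqI iffI)
    fix n assume "n \<in> {n. n mod A = B}"
    then have "n = A * (n div A) + B" by auto
    then show "n \<in> {A * r + B |r. r \<ge> 0}" by blast
  qed (use assms in auto)
  then show ?thesis
    by (auto simp: avoiding_paths_def dyck_path_iff_walk has_up_run_iff avoids_residue_def)
qed

section \<open>The cases of the grammar, told apart by the first block of U\<close>

context
  fixes A B :: nat and P :: "word set"
  assumes less: "B < A"
    and mem: "\<And>w. w \<in> P \<longleftrightarrow> walk 0 w \<and> avoids_residue A B w"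
begin

text \<open>The block list of a descent is the concatenation of those of its factors, so avoidance
  passes to the factors and back. The height is h = A in the long case and h = k - 1 in the short
  case.\<close>

lemma descent_mem_iff:
  "walk h w \<and> avoids_residue A B w \<longleftrightarrow>
    (\<exists>ps q. length ps = h \<and> set ps \<subseteq> P \<and> q \<in> P \<and> w = descent ps q)"
proof
  assume w: "walk h w \<and> avoids_residue A B w"
  then obtain ps q where "length ps = h" "\<forall>p\<in>set ps. walk 0 p" "walk 0 q" "w = descent ps q"
    using walk_descent_exists by blast
  with w show "\<exists>ps q. length ps = h \<and> set ps \<subseteq> P \<and> q \<in> P \<and> w = descent ps q"
    by (intro exI[of _ ps] exI[of _ q]) (auto simp: avoids_residue_descent mem)
next
  assume "\<exists>ps q. length ps = h \<and> set ps \<subseteq> P \<and> q \<in> P \<and> w = descent ps q"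
  then show "walk h w \<and> avoids_residue A B w"
    using walk_descent by (auto simp: avoids_residue_descent mem subset_iff)
qed

lemma long_case_mem: "w \<in> long_case P A \<longleftrightarrow> w \<in> P \<and> A \<le> hd (up_runs w)"
proof
  assume "w \<in> long_case P A"
  then obtain ps q where *: "length ps = A" "set ps \<subseteq> P" "q \<in> P" "w = replicate A U @ descent ps q"
    by (auto simp: long_case_iff long_factorization_def descent_def)
  then have "walk A (descent ps q) \<and> avoids_residue A B (descent ps q)"
    using descent_mem_iff by blast
  with * show "w \<in> P \<and> A \<le> hd (up_runs w)"
    by (simp add: mem avoids_residue_replicate)
next
  assume w: "w \<in> P \<and> A \<le> hd (up_runs w)"
  \<comment> \<open>The first block has k \<ge> A letters; \<open>v\<close> keeps the remaining k -
    A of them.\<close>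
  then obtain v where v: "w = replicate A U @ v"
  proof (cases w rule: word_first_run)
    case (1 k)
    with w show ?thesis
      using that[of "replicate (k - A) U"] by (simp flip: replicate_add)
  next
    case (2 k u)
    with w show ?thesis
      using that[of "replicate (k - A) U @ D # u"] by (simp flip: replicate_add append_assoc)
  qed
  with w have "walk A v \<and> avoids_residue A B v"
    by (simp add: mem avoids_residue_replicate)
  with v show "w \<in> long_case P A"
    using descent_mem_iff[of A v] unfolding long_case_iff
    by (fastforce simp: long_factorization_def descent_def)
qed

lemma short_case_mem:
  assumes "k < A" "k \<noteq> B"
  shows "w \<in> short_case P k \<longleftrightarrow> w \<in> P \<and> hd (up_runs w) = k"
proof (cases k)
  case 0
  \<comment> \<open>A path with empty first block would have to start with \<open>D\<close> at
    height 0 unless it is empty.\<close>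
  have "w = []" if "walk 0 w" "hd (up_runs w) = 0"
    using that by (cases w rule: up_runs.cases) auto
  moreover have "[] \<in> P" using assms 0 less by (simp add: mem avoids_residue_def)
  ultimately show ?thesis
    using 0 by (auto simp: short_case_iff short_factorization_def mem)
next
  case (Suc h)
  have "w \<in> short_case P k \<longleftrightarrow>
    (\<exists>ps q. length ps = h \<and> set ps \<subseteq> P \<and> q \<in> P \<and> w = replicate k U @ D # descent ps q)"
    (is "_ \<longleftrightarrow> ?R")
  proof
    assume "w \<in> short_case P k"
    then obtain qs where "length qs = Suc h" "set qs \<subseteq> P"
      "w = replicate k U @ concat (map ((#) D) qs)"
      by (auto simp: short_case_iff short_factorization_def Suc)
    moreover from this obtain ps q where "qs = ps @ [q]"
      by (auto simp: length_Suc_conv_rev)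
    ultimately show ?R
      unfolding concat_map_Cons_D[symmetric] by (intro exI[of _ ps] exI[of _ q]) auto
  next
    assume ?R
    then obtain ps q where "length ps = h" "set ps \<subseteq> P" "q \<in> P"
      "w = replicate k U @ concat (map ((#) D) (ps @ [q]))"
      unfolding concat_map_Cons_D by blast
    moreover have "(@) [D] = (#) D" by auto
    ultimately show "w \<in> short_case P k"
      unfolding short_case_iff short_factorization_def
      by (intro exI[of _ "ps @ [q]"]) (simp add: Suc)
  qed
  also have "\<dots> \<longleftrightarrow> (\<exists>v. w = replicate k U @ D # v \<and> walk h v \<and> avoids_residue A B v)"
    unfolding descent_mem_iff by blast
  also have "\<dots> \<longleftrightarrow> w \<in> P \<and> hd (up_runs w) = k"
  proof
    assume "\<exists>v. w = replicate k U @ D # v \<and> walk h v \<and> avoids_residue A B v"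
    then show "w \<in> P \<and> hd (up_runs w) = k"
      \<comment> \<open>As k < A, the first entry k is its own residue, and it differs from
        B.\<close>
      using assms Suc by (auto simp: mem avoids_residue_def)
  next
    assume w: "w \<in> P \<and> hd (up_runs w) = k"
    show "\<exists>v. w = replicate k U @ D # v \<and> walk h v \<and> avoids_residue A B v"
    proof (cases w rule: word_first_run)
      case (1 j)
      \<comment> \<open>A word U^j ends at height 0 only for j = 0, but its first block has length k
        > 0.\<close>
      have "walk 0 w" using w mem by blast
      then have "walk 0 (replicate j U @ [])" unfolding 1 by simp
      then have "j = 0" by (simp only: walk_replicate) simp
      with 1 w Suc show ?thesis by simp
    next
      case (2 j v)
      with w Suc show ?thesis by (auto simp: mem avoids_residue_def)
    qed
  qed
  finally show ?thesis .
qed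

end


theorem proposition7:
  fixes A B :: nat and P :: "word set" and F :: "int fps"
  assumes "B < A"
    and "P = avoiding_paths {A * r + B |r. r \<ge> 0}"
    and "F = weight_enumerator P"
  shows "P = (\<Union>k\<in>{k. 0 \<le> k \<and> k < A \<and> k \<noteq> B}. short_case P k) \<union> long_case P A
    \<and> (\<forall>w\<in>P. \<exists>!k. 0 \<le> k \<and> k \<le> A \<and> k \<noteq> B \<and>
          w \<in> (if k < A then short_case P k else long_case P A))
    \<and> (\<forall>k. 0 \<le> k \<and> k < A \<and> k \<noteq> B \<longrightarrow>
          (\<forall>w\<in>short_case P k. \<exists>!ps. short_factorization P k w ps))
    \<and> (\<forall>w\<in>long_case P A. \<exists>!f. long_factorization P A w f)
    \<and> F = (\<Sum>k\<in>{k. 0 \<le> k \<and> k < A \<and> k \<noteq> B}. fps_X ^ k * F ^ k) + fps_X ^ A * F ^ (A + 1)"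
proof -
  have mem: "w \<in> P \<longleftrightarrow> walk 0 w \<and> avoids_residue A B w" for w
    using avoiding_paths_residue[OF assms(1)] assms(2) by simp
  then have walks: "\<forall>p\<in>P. walk 0 p" by blast
  \<comment> \<open>Index A stands for the long form, so the case of a path is the length of its
    first block capped at A. Covering, disjointness and uniqueness of the case all follow from
    \<open>C_mem\<close> and \<open>first\<close>.\<close>
  define C where "C k = (if k < A then short_case P k else long_case P A)" for k
  define K where "K = {k. 0 \<le> k \<and> k < A \<and> k \<noteq> B}"
  have "finite K" "A \<notin> K" by (auto simp: K_def)
  have C_mem: "w \<in> C k \<longleftrightarrow> w \<in> P \<and> min A (hd (up_runs w)) = k" if "k \<in> insert A K" for k w
    using that short_case_mem[OF assms(1) mem] long_case_mem[OF assms(1) mem] assms(1)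
    by (auto simp: C_def K_def min_def)
  have first: "min A (hd (up_runs w)) \<in> insert A K" if "w \<in> P" for w
  proof -
    \<comment> \<open>Below A the length is its own residue, hence not B; from A on the cap gives
      the index A.\<close>
    have "hd (up_runs w) mod A \<noteq> B"
      using that by (simp add: mem avoids_residue_def)
    then show ?thesis by (auto simp: K_def min_def)
  qed
  have first_C: "w \<in> C (min A (hd (up_runs w)))" if "w \<in> P" for w
    using C_mem[OF first[OF that]] that by simp
  have P_eq: "P = (\<Union>k\<in>insert A K. C k)"
  proof (intro set_eqI iffI)
    fix w assume "w \<in> P"
    from UN_I[of _ "insert A K" w C, OF first[OF this] first_C[OF this]]
    show "w \<in> (\<Union>k\<in>insert A K. C k)" .
  next
    fix w assume "w \<in> (\<Union>k\<in>insert A K. C k)"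
    then obtain k where "k \<in> insert A K" "w \<in> C k" by (rule UN_E)
    then show "w \<in> P" using C_mem[of k w] by simp
  qed
  have cases_eq: "P = (\<Union>k\<in>K. short_case P k) \<union> long_case P A"
  proof -
    have "(\<Union>k\<in>K. C k) = (\<Union>k\<in>K. short_case P k)"
      by (intro SUP_cong) (auto simp: C_def K_def)
    moreover have "C A = long_case P A" by (simp add: C_def)
    ultimately have "(\<Union>k\<in>insert A K. C k) = (\<Union>k\<in>K. short_case P k) \<union> long_case P A"
      by (simp add: Un_commute)
    with P_eq show ?thesis by (rule trans)
  qed
  have unique: "\<exists>!k. 0 \<le> k \<and> k \<le> A \<and> k \<noteq> B \<and> w \<in> C k" if "w \<in> P" for w
  proof -
    have "\<exists>!k. k \<in> insert A K \<and> w \<in> C k"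
    proof (rule ex1I)
      show "min A (hd (up_runs w)) \<in> insert A K \<and> w \<in> C (min A (hd (up_runs w)))"
        using first[OF that] first_C[OF that] by simp
      show "k = min A (hd (up_runs w))" if "k \<in> insert A K \<and> w \<in> C k" for k
        using that C_mem[of k w] by simp
    qed
    moreover have "(0 \<le> k \<and> k \<le> A \<and> k \<noteq> B \<and> w \<in> C k) \<longleftrightarrow> (k \<in> insert A K \<and> w \<in> C k)" for k
      using assms(1) by (auto simp: K_def)
    ultimately show ?thesis by (simp only:)
  qed
  have "F = (\<Sum>k\<in>K. fps_X ^ k * F ^ k) + fps_X ^ A * F ^ (A + 1)"
  proof (rule fps_ext)
    fix n
    \<comment> \<open>The cases partition the paths of semilength n, so the coefficients add
      up.\<close>
    have "slice P n = (\<Union>k\<in>insert A K. slice (C k) n)"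
      by (subst P_eq) (auto simp: slice_def)
    moreover have "card (\<Union>k\<in>insert A K. slice (C k) n) = (\<Sum>k\<in>insert A K. card (slice (C k) n))"
    proof (intro card_UN_disjoint ballI impI)
      fix i j assume "i \<in> insert A K" "j \<in> insert A K" "i \<noteq> j"
      then have "C i \<inter> C j = {}" using C_mem[of i] C_mem[of j] by auto
      then show "slice (C i) n \<inter> slice (C j) n = {}" by (auto simp: slice_def)
    qed (use \<open>finite K\<close> in simp_all)
    ultimately have "int (card (slice P n)) =
        (\<Sum>k\<in>K. int (card (slice (C k) n))) + int (card (slice (C A) n))"
      using \<open>finite K\<close> \<open>A \<notin> K\<close> by simp
    also have "(\<Sum>k\<in>K. int (card (slice (C k) n))) = (\<Sum>k\<in>K. fps_nth (fps_X ^ k * F ^ k) n)"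
      unfolding assms(3) by (intro sum.cong) (simp_all add: C_def K_def card_slice_short_case[OF walks])
    also have "int (card (slice (C A) n)) = fps_nth (fps_X ^ A * F ^ (A + 1)) n"
      unfolding assms(3) by (simp add: C_def card_slice_long_case[OF walks])
    finally show "fps_nth F n = fps_nth ((\<Sum>k\<in>K. fps_X ^ k * F ^ k) + fps_X ^ A * F ^ (A + 1)) n"
      by (simp add: assms(3) weight_enumerator_nth fps_sum_nth)
  qed
  moreover have "\<forall>k. 0 \<le> k \<and> k < A \<and> k \<noteq> B \<longrightarrow>
      (\<forall>w\<in>short_case P k. \<exists>!ps. short_factorization P k w ps)"
    using short_factorization_unique[OF walks] short_case_iff by blast
  moreover have "\<forall>w\<in>long_case P A. \<exists>!f. long_factorization P A w f"
    using long_factorization_unique[OF walks] long_case_iff by blast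
  moreover have "\<forall>w\<in>P. \<exists>!k. 0 \<le> k \<and> k \<le> A \<and> k \<noteq> B \<and>
      w \<in> (if k < A then short_case P k else long_case P A)"
    using unique unfolding C_def by (rule ballI)
  ultimately show ?thesis
    using cases_eq unfolding K_def by (intro conjI)
qed

end
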